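(* Let $X^{0}=(X^0_n)_{n\ge 1}$ be a bounded sequence of non-negative real numbers (i.e. $X^{0}\in l^{\infty}\cap\mathbb{R}_{+}^{\mathbb{N}}$) and let $X$ be a positive componentwise solution, with initial condition $X^{0}$, of the system $$X_0(t)=0,\qquad \dot{X}_n(t)=k_{n-1}X_{n-1}^2(t)-k_nX_n(t)X_{n+1}(t)\quad (t\ge 0,\ n\ge 1),\qquad k_n=2^n.$$ Then $X$ has finite energy for positive times, i.e. $\sum_{n\ge1}X_n(t)^2<\infty$ for all $t>0$.
   Context: $\mathbb{N}=\{1,2,\dots\}$; $\mathbb{R}_+^{\mathbb{N}}$ is the set of sequences $(x_n)_{n\ge1}$ of non-negative real numbers; $l^\infty$ is the space of bounded real sequences. A componentwise solution with initial condition $X^0\in\mathbb{R}^{\mathbb{N}}$ is a sequence $X=(X_n(\cdot))_{n\ge1}$ of continuously differentiable functions $X_n:[0,\infty)\to\mathbb{R}$ with $X_n(0)=X^0_n$ for all $n$, satisfying all equations of the system. It is called positive if $X_n(t)\ge0$ for all $n\ge1$, $t\ge0$. *)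

theory Defs
  imports "HOL-Analysis.Analysis"
begin

text \<open>Sequences \<open>(x\<^sub>n)\<close> with \<open>n \<ge> 1\<close> are functions on \<^typ>\<open>nat\<close> whose value at
  \<open>0\<close> is disregarded.\<close>

definition C1_halfline :: "(real \<Rightarrow> real) \<Rightarrow> bool" where
  "C1_halfline f \<longleftrightarrow>
     (\<exists>f'. (\<forall>t\<ge>0. (f has_real_derivative f' t) (at t within {0..})) \<and> continuous_on {0..} f')"

definition dyadic_coeff :: "nat \<Rightarrow> real" where
  "dyadic_coeff n = 2 ^ n"

text \<open>The derivatives at \<open>t = 0\<close> are one-sided, since the components live on \<open>[0, \<infinity>)\<close>;
  their values at negative times are unconstrained. Index \<open>0\<close> of \<open>X\<close> is the auxiliary
  component \<open>X\<^sub>0 = 0\<close> of the system.\<close>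

definition componentwise_solution :: "(nat \<Rightarrow> real) \<Rightarrow> (nat \<Rightarrow> real \<Rightarrow> real) \<Rightarrow> bool" where
  "componentwise_solution x X \<longleftrightarrow>
     (\<forall>n\<ge>1. C1_halfline (X n)) \<and>
     (\<forall>n\<ge>1. X n 0 = x n) \<and>
     (\<forall>t\<ge>0. X 0 t = 0) \<and>
     (\<forall>n\<ge>1. \<forall>t\<ge>0. (X n has_real_derivative
        (dyadic_coeff (n - 1) * (X (n - 1) t)\<^sup>2 - dyadic_coeff n * X n t * X (n + 1) t)) (at t within {0..}))"

definition positive_solution :: "(nat \<Rightarrow> real) \<Rightarrow> (nat \<Rightarrow> real \<Rightarrow> real) \<Rightarrow> bool" where
  "positive_solution x X \<longleftrightarrow>
     componentwise_solution x X \<and> (\<forall>n\<ge>1. \<forall>t\<ge>0. X n t \<ge> 0)"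

end

theory Submission
  imports Defs "HOL-Real_Asymp.Real_Asymp"
begin

text \<open>
  The energy \<open>E\<^sub>n\<close> of the first \<open>n\<close> components satisfies \<open>E\<^sub>n' = - 2 k\<^sub>n X\<^sub>n\<^sup>2 X\<^sub>n\<^sub>+\<^sub>1 \<le> 0\<close>, so for
  initial data bounded by \<open>M\<close> one has \<open>E\<^sub>n(t) \<le> n M\<^sup>2\<close> and \<open>X\<^sub>n(t) \<le> n M\<close>. Differentiating \<open>X\<^sub>n\<^sup>2 X\<^sub>n\<^sub>+\<^sub>1\<close>
  produces the term \<open>k\<^sub>n X\<^sub>n\<^sup>4\<close>, while its negative terms are at most \<open>4 M (n + 2)\<close> times the flux
  \<open>k\<^sub>n X\<^sub>n\<^sup>2 X\<^sub>n\<^sub>+\<^sub>1\<close>. Hence \<open>k\<^sub>n X\<^sub>n\<^sup>4 \<le> G\<^sub>n'\<close> with \<open>G\<^sub>n = X\<^sub>n\<^sup>2 X\<^sub>n\<^sub>+\<^sub>1 - 2 M (n + 2) E\<^sub>n\<close>, whose total increase is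
  polynomial in \<open>n\<close>. Since \<open>X\<^sub>n\<^sup>2 \<le> (3/4)\<^sup>n + (4/3)\<^sup>n X\<^sub>n\<^sup>4\<close>, the time integral of \<open>E\<^sub>n\<close> over \<open>[0, T]\<close> is
  bounded uniformly in \<open>n\<close>, and as \<open>E\<^sub>n\<close> decreases in time it is at least \<open>T E\<^sub>n(T)\<close>. The integrals
  are avoided by exhibiting a nondecreasing function that encodes this estimate.
\<close>

text \<open>The one-sided derivative is two-sided at interior points; at \<open>0\<close> continuity
  suffices.\<close>

lemma halfline_deriv_nonneg_imp_le:
  fixes f f' :: "real \<Rightarrow> real"
  assumes deriv: "\<And>t. t \<ge> 0 \<Longrightarrow> (f has_real_derivative f' t) (at t within {0..})"
    and nonneg: "\<And>t. t \<ge> 0 \<Longrightarrow> f' t \<ge> 0"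
    and "0 \<le> T"
  shows "f 0 \<le> f T"
proof (rule DERIV_nonneg_imp_increasing_open[OF \<open>0 \<le> T\<close>])
  fix t assume t: "0 < t" "t < T"
  have "(f has_real_derivative f' t) (at t)"
    using deriv[of t] t at_within_interior[of t "{0..}"] by simp
  then show "\<exists>y. (f has_real_derivative y) (at t) \<and> y \<ge> 0"
    using nonneg t by (meson less_imp_le)
next
  have "continuous_on {0..} f"
    using deriv by (intro DERIV_continuous_on) auto
  then show "continuous_on {0..T} f"
    by (rule continuous_on_subset) auto
qed

lemma sq_le_plus_power4_divide:
  fixes y d :: real
  assumes "d > 0"
  shows "y\<^sup>2 \<le> d + y ^ 4 / d"
proof -
  have "d * y\<^sup>2 \<ge> 0"
    using assms by simp
  then have "d * y\<^sup>2 \<le> d\<^sup>2 + (y\<^sup>2)\<^sup>2"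
    using sum_squares_bound[of d "y\<^sup>2"] unfolding mult.assoc by linarith
  then show ?thesis
    using assms by (simp add: field_simps power2_eq_square power4_eq_xxxx)
qed

text \<open>Any ratio strictly between \<open>2/3\<close> and \<open>1\<close> absorbs the quadratic
  factor; \<open>3/4\<close> is one choice.\<close>

lemma summable_quadratic_geometric: "summable (\<lambda>n::nat. (2/3::real) ^ n * (real n + 2)\<^sup>2)"
proof (rule summable_comparison_test_bigo)
  show "summable (\<lambda>n. norm ((3/4::real) ^ n))"
    by simp
  show "(\<lambda>n. (2/3::real) ^ n * (real n + 2)\<^sup>2) \<in> O(\<lambda>n. (3/4) ^ n)"
    by real_asymp
qed

text \<open>The equations are indexed by \<open>Suc n\<close> to avoid truncated subtraction, and
  \<open>nonneg\<close> includes the auxiliary index \<open>0\<close>.\<close>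

locale dyadic_positive =
  fixes X :: "nat \<Rightarrow> real \<Rightarrow> real" and M :: real
  assumes zero: "t \<ge> 0 \<Longrightarrow> X 0 t = 0"
    and nonneg: "t \<ge> 0 \<Longrightarrow> X n t \<ge> 0"
    and deriv_Suc: "t \<ge> 0 \<Longrightarrow> (X (Suc n) has_real_derivative
      2 ^ n * (X n t)\<^sup>2 - 2 ^ Suc n * X (Suc n) t * X (Suc (Suc n)) t) (at t within {0..})"
    and initial_le: "n \<ge> 1 \<Longrightarrow> X n 0 \<le> M"
begin

section \<open>Energy balance and growth bounds\<close>

lemma M_nonneg: "M \<ge> 0"
  using initial_le[of 1] nonneg[of 0 1] by simp

definition energy :: "nat \<Rightarrow> real \<Rightarrow> real" where
  "energy n t = (\<Sum>i=1..n. (X i t)\<^sup>2)"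

lemma energy_nonneg: "energy n t \<ge> 0"
  by (simp add: energy_def sum_nonneg)

text \<open>The balance telescopes: the gain of \<open>(X (Suc n) t)\<^sup>2\<close> cancels the
  outflow from the first \<open>n\<close> components.\<close>

lemma energy_deriv:
  assumes "t \<ge> 0"
  shows "(energy n has_real_derivative - 2 * 2 ^ n * (X n t)\<^sup>2 * X (Suc n) t) (at t within {0..})"
proof (induction n)
  case 0
  then show ?case
    using assms by (simp add: energy_def[abs_def] zero)
next
  case (Suc n)
  have eq: "energy (Suc n) = (\<lambda>t. energy n t + (X (Suc n) t)\<^sup>2)"
    by (simp add: energy_def fun_eq_iff)
  show ?case
    unfolding eq
    by (rule derivative_eq_intros Suc deriv_Suc[OF assms] refl)+
      (simp add: algebra_simps power2_eq_square)
qed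

lemma energy_le:
  assumes "t \<ge> 0"
  shows "energy n t \<le> real n * M\<^sup>2"
proof -
  have "- energy n 0 \<le> - energy n t"
    by (rule halfline_deriv_nonneg_imp_le[OF DERIV_minus[OF energy_deriv]])
      (use assms in \<open>simp_all add: nonneg\<close>)
  moreover have "energy n 0 \<le> (\<Sum>i=1..n. M\<^sup>2)"
    unfolding energy_def by (intro sum_mono power_mono) (auto simp: nonneg initial_le)
  ultimately show ?thesis
    by simp
qed

lemma sq_le:
  assumes "t \<ge> 0"
  shows "(X n t)\<^sup>2 \<le> real n * M\<^sup>2"
proof (cases n)
  case 0
  then show ?thesis
    using zero[OF assms] by simp
next
  case (Suc m)
  have "(X n t)\<^sup>2 \<le> energy n t"
    unfolding energy_def using Suc by (intro member_le_sum) auto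
  then show ?thesis
    using energy_le[OF assms, of n] by simp
qed

lemma le_linear:
  assumes "t \<ge> 0"
  shows "X n t \<le> real n * M"
proof (rule power2_le_imp_le)
  \<comment> \<open>Weakening the factor \<open>sqrt n\<close> to \<open>n\<close> avoids square
    roots; polynomial growth is enough.\<close>
  have "real n \<le> (real n)\<^sup>2"
    by (cases n) (simp_all add: power2_eq_square)
  then have "real n * M\<^sup>2 \<le> (real n)\<^sup>2 * M\<^sup>2"
    by (intro mult_right_mono) auto
  then show "(X n t)\<^sup>2 \<le> (real n * M)\<^sup>2"
    using sq_le[OF assms, of n] by (simp add: power_mult_distrib)
qed (simp add: M_nonneg)

section \<open>A functional whose growth controls fourth powers\<close>

definition potential :: "nat \<Rightarrow> real \<Rightarrow> real" where
  "potential n t = (X n t)\<^sup>2 * X (Suc n) t - 2 * M * (real n + 2) * energy n t"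

lemma potential_deriv:
  assumes "n \<ge> 1" "t \<ge> 0"
  obtains d where "(potential n has_real_derivative d) (at t within {0..})"
    and "2 ^ n * X n t ^ 4 \<le> d"
proof -
  obtain m where m: "n = Suc m"
    using assms(1) by (cases n) auto
  define w where "w = X m t"
  define a where "a = X n t"
  define b where "b = X (Suc n) t"
  define c where "c = X (Suc (Suc n)) t"
  have pos: "w \<ge> 0" "a \<ge> 0" "b \<ge> 0" "c \<ge> 0"
    using nonneg[OF assms(2)] by (auto simp: w_def a_def b_def c_def)
  have b: "b \<le> M * (real n + 2)" and c: "c \<le> M * (real n + 2)"
    using le_linear[OF assms(2), of "Suc n"] le_linear[OF assms(2), of "Suc (Suc n)"] M_nonneg
    by (auto simp: b_def c_def algebra_simps)
  define d where "d = 2 * a * (2 ^ m * w\<^sup>2 - 2 ^ n * a * b) * b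
    + a\<^sup>2 * (2 ^ n * a\<^sup>2 - 2 * 2 ^ n * b * c) - 2 * M * (real n + 2) * (- 2 * 2 ^ n * a\<^sup>2 * b)"
  have Xn: "(X n has_real_derivative 2 ^ m * w\<^sup>2 - 2 ^ n * a * b) (at t within {0..})"
    using deriv_Suc[OF assms(2), of m] by (simp add: m w_def a_def b_def)
  have XSn: "(X (Suc n) has_real_derivative 2 ^ n * a\<^sup>2 - 2 * 2 ^ n * b * c) (at t within {0..})"
    using deriv_Suc[OF assms(2), of n] by (simp add: a_def b_def c_def)
  have En: "(energy n has_real_derivative - 2 * 2 ^ n * a\<^sup>2 * b) (at t within {0..})"
    using energy_deriv[OF assms(2), of n] by (simp add: a_def b_def)
  have "(potential n has_real_derivative d) (at t within {0..})"
    unfolding potential_def[abs_def] d_def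
    by (rule derivative_eq_intros Xn XSn En refl)+
      (simp add: a_def b_def algebra_simps)
  moreover have "2 ^ n * a ^ 4 \<le> d"
  proof -
    \<comment> \<open>The energy term supplies \<open>4 * M * (n + 2)\<close> times
      \<open>2 ^ n * a\<^sup>2 * b\<close>, half of it to absorb the loss with factor
      \<open>b\<close>, half for the loss with factor \<open>c\<close>.\<close>
    have "d - 2 ^ n * a ^ 4 = 2 * 2 ^ m * a * b * w\<^sup>2
        + 2 * 2 ^ n * a\<^sup>2 * b * ((M * (real n + 2) - b) + (M * (real n + 2) - c))"
      unfolding d_def by (simp add: algebra_simps power2_eq_square power4_eq_xxxx)
    also have "\<dots> \<ge> 0"
      using pos b c by (intro add_nonneg_nonneg mult_nonneg_nonneg) auto
    finally show ?thesis
      by simp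
  qed
  ultimately show ?thesis
    using that by (simp add: a_def)
qed

lemma potential_increase:
  assumes "t \<ge> 0"
  shows "potential n t - potential n 0 \<le> 3 * M ^ 3 * (real n + 2)\<^sup>2"
proof -
  have "(X n t)\<^sup>2 * X (Suc n) t \<le> (real n * M\<^sup>2) * (real (Suc n) * M)"
    using M_nonneg by (intro mult_mono sq_le[OF assms] le_linear[OF assms] nonneg[OF assms]) simp
  moreover have "2 * M * (real n + 2) * energy n 0 \<le> 2 * M * (real n + 2) * (real n * M\<^sup>2)"
    using M_nonneg energy_le[of 0 n] by (intro mult_left_mono) auto
  moreover have "(X n 0)\<^sup>2 * X (Suc n) 0 \<ge> 0" "2 * M * (real n + 2) * energy n t \<ge> 0"
    using M_nonneg energy_nonneg nonneg by auto
  ultimately have "potential n t - potential n 0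
      \<le> (real n * M\<^sup>2) * (real (Suc n) * M) + 2 * M * (real n + 2) * (real n * M\<^sup>2)"
    unfolding potential_def by linarith
  also have "\<dots> = M ^ 3 * (real n * (real n + 1) + 2 * (real n + 2) * real n)"
    by (simp add: algebra_simps power2_eq_square power3_eq_cube)
  also have "\<dots> \<le> M ^ 3 * (3 * (real n + 2)\<^sup>2)"
    using M_nonneg by (intro mult_left_mono) (auto simp: algebra_simps power2_eq_square)
  finally show ?thesis
    by simp
qed

section \<open>Time-averaged energy and its uniform bound\<close>

lemma time_energy_le:
  assumes "T \<ge> 0"
  shows "T * energy N T
    \<le> (\<Sum>n=1..N. (3/4) ^ n * T + (2/3) ^ n * (potential n T - potential n 0))"
proof -
  \<comment> \<open>\<open>potential_deriv\<close> only gives existence at each \<open>n\<close> and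
    \<open>t\<close>; choice turns this into a derivative function.\<close>
  define D where "D n t = (SOME d. (potential n has_real_derivative d) (at t within {0..})
    \<and> 2 ^ n * X n t ^ 4 \<le> d)" for n t
  have D: "(potential n has_real_derivative D n t) (at t within {0..})" "2 ^ n * X n t ^ 4 \<le> D n t"
    if "n \<ge> 1" "t \<ge> 0" for n t
  proof -
    have "\<exists>d. (potential n has_real_derivative d) (at t within {0..}) \<and> 2 ^ n * X n t ^ 4 \<le> d"
      using potential_deriv[OF that] by metis
    then show "(potential n has_real_derivative D n t) (at t within {0..})"
      "2 ^ n * X n t ^ 4 \<le> D n t"
      unfolding D_def by (metis (mono_tags, lifting) someI_ex)+
  qed
  \<comment> \<open>The term \<open>t * energy N t\<close> replaces the time integral of the energy:
    its derivative is at most \<open>energy N t\<close>, since the energy decreases.\<close>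
  define \<Phi> where "\<Phi> t = (\<Sum>n=1..N. (3/4) ^ n * t + (2/3) ^ n * potential n t) - t * energy N t" for t
  have "\<Phi> 0 \<le> \<Phi> T"
  proof (rule halfline_deriv_nonneg_imp_le[OF _ _ assms])
    fix t :: real assume t: "t \<ge> 0"
    show "(\<Phi> has_real_derivative (\<Sum>n=1..N. (3/4) ^ n + (2/3) ^ n * D n t)
        - (energy N t + t * (- 2 * 2 ^ N * (X N t)\<^sup>2 * X (Suc N) t))) (at t within {0..})"
      unfolding \<Phi>_def[abs_def]
      by (rule derivative_eq_intros DERIV_sum D(1) energy_deriv[OF t] t refl | simp add: mult.commute)+
    have "energy N t \<le> (\<Sum>n=1..N. (3/4) ^ n + (2/3) ^ n * D n t)"
      unfolding energy_def
    proof (rule sum_mono)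
      fix n assume n: "n \<in> {1..N}"
      \<comment> \<open>For a ratio \<open>r\<close> in place of \<open>3/4\<close>, the weight on
        \<open>D n t\<close> is \<open>(1 / (2 * r)) ^ n\<close>; both are summable when
        \<open>1/2 < r < 1\<close>.\<close>
      have "(X n t)\<^sup>2 \<le> (3/4) ^ n + X n t ^ 4 / (3/4) ^ n"
        by (rule sq_le_plus_power4_divide) simp
      also have "X n t ^ 4 / (3/4) ^ n = (2/3) ^ n * (2 ^ n * X n t ^ 4)"
        by (simp add: power_divide field_simps flip: power_mult_distrib)
      also have "\<dots> \<le> (2/3) ^ n * D n t"
        using D(2)[of n t] n t by (intro mult_left_mono) auto
      finally show "(X n t)\<^sup>2 \<le> (3/4) ^ n + (2/3) ^ n * D n t"
        by simp
    qed
    moreover have "t * (- 2 * 2 ^ N * (X N t)\<^sup>2 * X (Suc N) t) \<le> 0"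
      using t nonneg[OF t] by (intro mult_nonneg_nonpos mult_nonpos_nonneg) auto
    ultimately show "(\<Sum>n=1..N. (3/4) ^ n + (2/3) ^ n * D n t)
        - (energy N t + t * (- 2 * 2 ^ N * (X N t)\<^sup>2 * X (Suc N) t)) \<ge> 0"
      by linarith
  qed
  then show ?thesis
    unfolding \<Phi>_def by (simp add: sum.distrib sum_subtractf right_diff_distrib)
qed

text \<open>The bound on \<open>T * energy N T\<close> is a partial sum of two convergent series
  with nonnegative terms, so dividing by \<open>T\<close> leaves a constant independent of
  \<open>N\<close>.\<close>

lemma energy_bounded:
  assumes "T > 0"
  obtains C where "\<And>N. energy N T \<le> C"
proof -
  define S where "S = (\<Sum>n. (3/4::real) ^ n * T) + (\<Sum>n. (2/3) ^ n * (real n + 2)\<^sup>2 * (3 * M ^ 3))"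
  have summ: "summable (\<lambda>n. (3/4::real) ^ n * T)"
    "summable (\<lambda>n. (2/3) ^ n * (real n + 2)\<^sup>2 * (3 * M ^ 3))"
    by (intro summable_mult2 summable_geometric summable_quadratic_geometric; simp)+
  have "energy N T \<le> S / T" for N
  proof -
    have "T * energy N T
        \<le> (\<Sum>n=1..N. (3/4) ^ n * T + (2/3) ^ n * (potential n T - potential n 0))"
      using time_energy_le assms by simp
    also have "\<dots> \<le> (\<Sum>n=1..N. (3/4) ^ n * T + (2/3) ^ n * (3 * M ^ 3 * (real n + 2)\<^sup>2))"
      using potential_increase[of T] assms by (intro sum_mono add_mono mult_left_mono) auto
    also have "\<dots> = (\<Sum>n=1..N. (3/4) ^ n * T) + (\<Sum>n=1..N. (2/3) ^ n * (real n + 2)\<^sup>2 * (3 * M ^ 3))"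
      by (simp add: sum.distrib mult_ac)
    also have "\<dots> \<le> S"
      unfolding S_def using assms M_nonneg summ by (intro add_mono sum_le_suminf) auto
    finally show ?thesis
      using assms by (simp add: field_simps)
  qed
  then show ?thesis
    by (rule that)
qed

lemma sq_summable_on:
  assumes "T > 0"
  shows "(\<lambda>n. (X n T)\<^sup>2) summable_on {1..}"
proof (rule nonneg_bdd_above_summable_on)
  obtain C where C: "\<And>N. energy N T \<le> C"
    using energy_bounded[OF assms] by blast
  show "bdd_above (sum (\<lambda>n. (X n T)\<^sup>2) ` {F. F \<subseteq> {1..} \<and> finite F})"
  proof (rule bdd_aboveI2)
    fix F :: "nat set" assume "F \<in> {F. F \<subseteq> {1..} \<and> finite F}"
    \<comment> \<open>For empty \<open>F\<close> the value of \<open>Max F\<close> is arbitrary, but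
      the inclusion is trivial.\<close>
    then have "F \<subseteq> {1..Max F}"
      by auto
    then have "(\<Sum>n\<in>F. (X n T)\<^sup>2) \<le> energy (Max F) T"
      unfolding energy_def by (intro sum_mono2) auto
    also have "\<dots> \<le> C"
      by (rule C)
    finally show "(\<Sum>n\<in>F. (X n T)\<^sup>2) \<le> C" .
  qed
qed simp

end

theorem theorem5:
  fixes x :: "nat \<Rightarrow> real" and X :: "nat \<Rightarrow> real \<Rightarrow> real"
  assumes "bounded (x ` {1..})"
    and "\<forall>n\<ge>1. x n \<ge> 0"
    and "positive_solution x X"
  shows "\<forall>t>0. (\<lambda>n. (X n t)\<^sup>2) summable_on {1..}"
proof -
  obtain M where M: "\<And>n. n \<ge> 1 \<Longrightarrow> \<bar>x n\<bar> \<le> M"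
    using assms(1) by (auto simp: bounded_iff)
  have sol: "componentwise_solution x X" and pos: "\<And>n t. n \<ge> 1 \<Longrightarrow> t \<ge> 0 \<Longrightarrow> X n t \<ge> 0"
    using assms(3) by (auto simp: positive_solution_def)
  have zero: "\<And>t. t \<ge> 0 \<Longrightarrow> X 0 t = 0" and init: "\<And>n. n \<ge> 1 \<Longrightarrow> X n 0 = x n"
    using sol by (auto simp: componentwise_solution_def)
  have deriv: "(X n has_real_derivative (dyadic_coeff (n - 1) * (X (n - 1) t)\<^sup>2
      - dyadic_coeff n * X n t * X (n + 1) t)) (at t within {0..})" if "n \<ge> 1" "t \<ge> 0" for n t
    using sol that unfolding componentwise_solution_def by blast
  interpret dyadic_positive X M
  proof
    fix t :: real and n :: nat
    assume t: "t \<ge> 0"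
    show "X 0 t = 0"
      using zero t .
    show "X n t \<ge> 0"
      using zero pos t by (cases n) auto
    show "(X (Suc n) has_real_derivative
        2 ^ n * (X n t)\<^sup>2 - 2 ^ Suc n * X (Suc n) t * X (Suc (Suc n)) t) (at t within {0..})"
      using deriv[of "Suc n" t] t by (simp add: dyadic_coeff_def)
  next
    fix n :: nat assume "n \<ge> 1"
    then show "X n 0 \<le> M"
      using M[of n] init[of n] by simp
  qed
  show ?thesis
    using sq_summable_on by blast
qed

end
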